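(* Let $\mathfrak{o}$ be a norm-finite Dedekind domain, $U=\mathrm{GL}_2(\mathfrak{o})$, let $a,b,c\in\mathfrak{o}$ be nonzero, and let $A=\begin{pmatrix}1&0\\0&a\end{pmatrix}$, $B=\begin{pmatrix}1&0\\0&b\end{pmatrix}$, $C=\begin{pmatrix}1&0\\0&c\end{pmatrix}$. Then, for the product $*$ of the Hecke algebra $H$, $(1_{UAU}*1_{UBU})(C)=1$ if $c\in ab\,\mathfrak{o}^*$, and $(1_{UAU}*1_{UBU})(C)=0$ otherwise.
   Context: A Dedekind domain $\mathfrak{o}$ is called norm-finite if $|\mathfrak{o}/a\mathfrak{o}|<\infty$ for every nonzero $a\in\mathfrak{o}$. $\mathfrak{o}^*$ is the unit group of $\mathfrak{o}$. Let $I$ be the set of matrices in $\mathfrak{o}^{2\times2}$ with nonzero determinant. For $M\subseteq I$ let $1_M:I\to\{0,1\}$ be the characteristic function of $M$. The Hecke algebra $H$ is the complex vector space spanned by $\{1_{UAU}\mid A\in I\}$. Its product $*$ is defined as follows: for $A,B\in I$, write $UAU=UA_1\cup\dots\cup UA_k$ and $UBU=UB_1\cup\dots\cup UB_m$ as disjoint unions of right cosets (there are finitely many), and set $$1_{UAU}*1_{UBU}=\sum_{i=1}^k\sum_{j=1}^m 1_{UA_iB_j};$$ this is extended bilinearly to a well-defined operation on $H$. Equivalently, $(1_{UAU}*1_{UBU})(C)=|\{(i,j)\mid A_iB_j\in UC,\ 1\le i\le k,\ 1\le j\le m\}|$ for $C\in I$. *)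

theory Defs
  imports
    "HOL-Analysis.Determinants"
    "HOL-Library.Function_Algebras"
    "HOL-Library.Indicator_Function"
    "HOL-Computational_Algebra.Polynomial_Factorial"
    "HOL-Algebra.Algebraic_Closure_Type"
begin

section \<open>Norm-finite Dedekind domains\<close>

text \<open>The domain is the universe of a type of class \<open>idom\<close>; ideals are those of the associated
  HOL-Algebra ring \<open>ring_of_type_algebra\<close>. Integrality over the domain is witnessed by a monic
  polynomial, and \<open>'a fract\<close> is the field of fractions. Fields are not excluded.\<close>

definition integrally_closed :: "'a::idom itself \<Rightarrow> bool" where
  "integrally_closed _ \<longleftrightarrow>
    (\<forall>x :: 'a fract. (\<exists>p :: 'a poly. lead_coeff p = 1 \<and> poly (map_poly to_fract p) x = 0)
      \<longrightarrow> x \<in> range to_fract)"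

definition dedekind_domain :: "'a::idom itself \<Rightarrow> bool" where
  "dedekind_domain T \<longleftrightarrow>
    noetherian_domain (ring_of_type_algebra :: 'a ring) \<and>
    integrally_closed T \<and>
    (\<forall>P. primeideal P (ring_of_type_algebra :: 'a ring) \<and> P \<noteq> {0}
      \<longrightarrow> maximalideal P (ring_of_type_algebra :: 'a ring))"

definition norm_finite :: "'a::idom itself \<Rightarrow> bool" where
  "norm_finite _ \<longleftrightarrow>
    (\<forall>a::'a. a \<noteq> 0 \<longrightarrow>
      finite (carrier (ring_of_type_algebra Quot (PIdl\<^bsub>ring_of_type_algebra\<^esub> a))))"


section \<open>Cosets\<close>

definition GL2 :: "('a::idom^2^2) set" where
  "GL2 = {u. invertible u}"

definition nonsingular :: "('a::idom^2^2) set" where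
  "nonsingular = {A. det A \<noteq> 0}"

definition right_coset :: "'a::idom^2^2 \<Rightarrow> ('a^2^2) set" where
  "right_coset A = {u ** A | u. u \<in> GL2}"

definition double_coset :: "'a::idom^2^2 \<Rightarrow> ('a^2^2) set" where
  "double_coset A = {u ** A ** v | u v. u \<in> GL2 \<and> v \<in> GL2}"

definition double_cosets :: "('a::idom^2^2) set set" where
  "double_cosets = double_coset ` nonsingular"

definition right_cosets_in :: "('a::idom^2^2) set \<Rightarrow> ('a^2^2) set set" where
  "right_cosets_in D = right_coset ` D"

definition coset_rep :: "('a::idom^2^2) set \<Rightarrow> 'a^2^2" where
  "coset_rep D = (SOME A. A \<in> D)"

lemma GL2_one: "mat 1 \<in> GL2"
  unfolding GL2_def invertible_def by (auto intro: exI[of _ "mat 1"])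

lemma GL2_mult: "u \<in> GL2 \<Longrightarrow> v \<in> GL2 \<Longrightarrow> u ** v \<in> GL2"
  unfolding GL2_def by (simp add: invertible_mult)

lemma GL2_inverse:
  assumes "u \<in> GL2" obtains v where "v \<in> GL2" "u ** v = mat 1" "v ** u = mat 1"
  using assms unfolding GL2_def invertible_def by blast

lemma right_coset_self: "A \<in> right_coset A"
  unfolding right_coset_def using GL2_one by (force intro: exI[of _ "mat 1"])

lemma double_coset_self: "A \<in> double_coset A"
  unfolding double_coset_def using GL2_one by (force intro: exI[of _ "mat 1"])

lemma right_coset_GL2_mult:
  assumes "u \<in> GL2" shows "right_coset (u ** A) = right_coset A"
proof -
  obtain v where v: "v \<in> GL2" "u ** v = mat 1" "v ** u = mat 1"
    using GL2_inverse[OF assms] .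
  have "w ** A = (w ** v) ** (u ** A)" for w
    by (metis matrix_mul_assoc matrix_mul_rid v(3))
  moreover have "w ** (u ** A) = (w ** u) ** A" for w
    by (simp add: matrix_mul_assoc)
  ultimately show ?thesis
    unfolding right_coset_def using assms v(1) by (blast intro: GL2_mult)
qed

lemma right_coset_eq:
  assumes "B \<in> right_coset A" shows "right_coset B = right_coset A"
proof -
  obtain u where "u \<in> GL2" "B = u ** A" using assms unfolding right_coset_def by blast
  thus ?thesis using right_coset_GL2_mult by simp
qed

lemma double_coset_mult:
  assumes "u \<in> GL2" "v \<in> GL2" "B \<in> double_coset A"
  shows "u ** B ** v \<in> double_coset A"
proof -
  obtain r s where "r \<in> GL2" "s \<in> GL2" "B = r ** A ** s"
    using assms(3) by (auto simp: double_coset_def)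
  hence "u ** B ** v = (u ** r) ** A ** (s ** v)" "u ** r \<in> GL2" "s ** v \<in> GL2"
    using assms by (simp_all add: matrix_mul_assoc GL2_mult)
  thus ?thesis unfolding double_coset_def by blast
qed

lemma double_coset_eq:
  assumes "B \<in> double_coset A" shows "double_coset B = double_coset A"
proof -
  have sub: "double_coset W \<subseteq> double_coset Z" if "W \<in> double_coset Z" for Z W :: "'a^2^2"
    using double_coset_mult[OF _ _ that] by (auto simp: double_coset_def[of W])
  obtain r s where rs: "r \<in> GL2" "s \<in> GL2" "B = r ** A ** s"
    using assms by (auto simp: double_coset_def)
  obtain r' where r': "r' \<in> GL2" "r' ** r = mat 1" using GL2_inverse[OF rs(1)] by metis
  obtain s' where s': "s' \<in> GL2" "s ** s' = mat 1" using GL2_inverse[OF rs(2)] by metis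
  have "r' ** B ** s' = (r' ** r) ** A ** (s ** s')"
    using rs(3) by (simp add: matrix_mul_assoc)
  hence "A = r' ** B ** s'" using r' s' by simp
  hence "A \<in> double_coset B" unfolding double_coset_def using r' s' by blast
  thus ?thesis using sub assms by blast
qed

lemma coset_rep_in_double_coset: "D \<in> double_cosets \<Longrightarrow> coset_rep D \<in> D"
  unfolding double_cosets_def coset_rep_def using double_coset_self by (metis imageE someI)

lemma double_cosets_disjoint:
  "D \<in> double_cosets \<Longrightarrow> E \<in> double_cosets \<Longrightarrow> Z \<in> D \<Longrightarrow> Z \<in> E \<Longrightarrow> D = E"
  unfolding double_cosets_def using double_coset_eq by blast


section \<open>The Hecke algebra\<close>

text \<open>Complex functions on the set of nonsingular matrices are represented by functions on all
  matrices that vanish on the singular ones.\<close>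

abbreviation char_fun :: "('a::idom^2^2) set \<Rightarrow> 'a^2^2 \<Rightarrow> complex" where
  "char_fun \<equiv> indicator"

definition hecke_algebra :: "('a::idom^2^2 \<Rightarrow> complex) set" where
  "hecke_algebra = Modules.module.span (\<lambda>(c::complex) f Z. c * f Z) (char_fun ` double_cosets)"

definition hecke_basis_mult ::
    "('a::idom^2^2) set \<Rightarrow> ('a^2^2) set \<Rightarrow> 'a^2^2 \<Rightarrow> complex" where
  "hecke_basis_mult D E =
    (\<Sum>P\<in>right_cosets_in D. \<Sum>Q\<in>right_cosets_in E.
      char_fun (right_coset (coset_rep P ** coset_rep Q)))"

text \<open>For \<open>f\<close> in the Hecke algebra the coefficient at the basis element \<open>char_fun D\<close> is the
  constant value of \<open>f\<close> on \<open>D\<close>, so the following is the bilinear extension of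
  \<open>hecke_basis_mult\<close>.\<close>

definition hecke_mult ::
    "('a::idom^2^2 \<Rightarrow> complex) \<Rightarrow> ('a^2^2 \<Rightarrow> complex) \<Rightarrow> 'a^2^2 \<Rightarrow> complex"
    (infixl \<open>\<star>\<close> 70) where
  "f \<star> g = (\<lambda>Z.
    \<Sum>D | D \<in> double_cosets \<and> f (coset_rep D) \<noteq> 0.
    \<Sum>E | E \<in> double_cosets \<and> g (coset_rep E) \<noteq> 0.
      f (coset_rep D) * g (coset_rep E) * hecke_basis_mult D E Z)"


subsection \<open>Basis formula, bilinearity and independence of representatives\<close>

lemma sum_fun_apply: "(\<Sum>i\<in>I. F i) x = (\<Sum>i\<in>I. F i x)"
  by (induction I rule: infinite_finite_induct) auto

lemma right_cosets_in_shift: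
  assumes "u \<in> GL2"
  shows "bij_betw (\<lambda>P. (\<lambda>A. A ** u) ` P)
    (right_cosets_in (double_coset A)) (right_cosets_in (double_coset A))"
proof -
  obtain v where v: "v \<in> GL2" "u ** v = mat 1" "v ** u = mat 1"
    using GL2_inverse[OF assms] .
  have img: "(\<lambda>A. A ** w) ` right_coset B = right_coset (B ** w)" for w B :: "'a^2^2"
    unfolding right_coset_def by (force simp: matrix_mul_assoc)
  have into: "(\<lambda>A. A ** w) ` P \<in> right_cosets_in (double_coset A)"
    if "w \<in> GL2" "P \<in> right_cosets_in (double_coset A)" for w P
    using that double_coset_mult[OF GL2_one that(1)]
    by (auto simp: right_cosets_in_def img)
  have cancel: "(\<lambda>A. A ** w') ` (\<lambda>A. A ** w) ` P = P" if "w ** w' = mat 1" for w w' P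
    using that by (simp add: image_image flip: matrix_mul_assoc)
  show ?thesis
    by (rule bij_betw_byWitness[where f' = "\<lambda>P. (\<lambda>A. A ** v) ` P"])
      (use assms v in \<open>auto simp: cancel into\<close>)
qed

lemma hecke_basis_mult_any_reps:
  assumes D: "D \<in> double_cosets" and E: "E \<in> double_cosets"
    and a: "\<And>P. P \<in> right_cosets_in D \<Longrightarrow> a P \<in> P"
    and b: "\<And>Q. Q \<in> right_cosets_in E \<Longrightarrow> b Q \<in> Q"
  shows "hecke_basis_mult D E =
    (\<Sum>P\<in>right_cosets_in D. \<Sum>Q\<in>right_cosets_in E. char_fun (right_coset (a P ** b Q)))"
proof -
  define r :: "('a^2^2) set \<Rightarrow> 'a^2^2" where "r = coset_rep"
  obtain A where A: "D = double_coset A" using D by (auto simp: double_cosets_def)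
  have r: "r P \<in> P" if "P \<in> right_cosets_in M" for P M
    using that right_coset_self unfolding r_def coset_rep_def right_cosets_in_def
    by (metis imageE someI)
  have *: "(\<Sum>P\<in>right_cosets_in D. char_fun (right_coset (r P ** r Q))) =
      (\<Sum>P\<in>right_cosets_in D. char_fun (right_coset (a P ** b Q)))"
    if Q: "Q \<in> right_cosets_in E" for Q
  proof -
    obtain B where B: "Q = right_coset B" using Q by (auto simp: right_cosets_in_def)
    have "right_coset (r Q) = Q" using r[OF Q] right_coset_eq B by metis
    then obtain u where u: "u \<in> GL2" "b Q = u ** r Q"
      using b[OF Q] by (auto simp: right_coset_def)
    have "right_coset (r ((\<lambda>A. A ** u) ` P) ** r Q) = right_coset (a P ** b Q)"
      if P: "P \<in> right_cosets_in D" for P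
    proof -
      have "(\<lambda>A. A ** u) ` P \<in> right_cosets_in D"
        using bij_betw_apply[OF right_cosets_in_shift[OF u(1)]] P A by blast
      then obtain Z where Z: "Z \<in> P" "r ((\<lambda>A. A ** u) ` P) = Z ** u"
        using r by blast
      have "right_coset Z = P" "right_coset (a P) = P"
        using Z(1) a[OF P] P right_coset_eq by (auto simp: right_cosets_in_def)
      then obtain w where w: "w \<in> GL2" "Z = w ** a P"
        using Z(1) by (auto simp: right_coset_def)
      have "r ((\<lambda>A. A ** u) ` P) ** r Q = w ** (a P ** b Q)"
        using Z w u by (simp add: matrix_mul_assoc)
      thus ?thesis using right_coset_GL2_mult[OF w(1)] by simp
    qed
    hence "(\<Sum>P\<in>right_cosets_in D. char_fun (right_coset (a P ** b Q))) =
        (\<Sum>P\<in>right_cosets_in D. char_fun (right_coset (r ((\<lambda>A. A ** u) ` P) ** r Q)))"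
      by (intro sum.cong) auto
    also have "\<dots> = (\<Sum>P\<in>right_cosets_in D. char_fun (right_coset (r P ** r Q)))"
      unfolding A by (rule sum.reindex_bij_betw[OF right_cosets_in_shift[OF u(1)]])
    finally show ?thesis ..
  qed
  show ?thesis
    unfolding hecke_basis_mult_def r_def[symmetric]
    by (subst (1 2) sum.swap) (intro sum.cong refl *)
qed

lemma char_fun_coset_rep:
  "D \<in> double_cosets \<Longrightarrow> E \<in> double_cosets \<Longrightarrow>
    char_fun D (coset_rep E) = (if D = E then 1 else 0)"
  using coset_rep_in_double_coset double_cosets_disjoint by (auto simp: indicator_def)

lemma hecke_mult_char_fun:
  assumes "D \<in> double_cosets" "E \<in> double_cosets"
  shows "char_fun D \<star> char_fun E = hecke_basis_mult D E"
proof -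
  have "{D'. D' \<in> double_cosets \<and> char_fun M (coset_rep D') \<noteq> 0} = {M}"
    if "M \<in> double_cosets" for M :: "('a^2^2) set"
    using that by (auto simp: char_fun_coset_rep split: if_splits)
  thus ?thesis using assms by (simp add: hecke_mult_def char_fun_coset_rep)
qed

lemma module_fun: "Modules.module (\<lambda>(c::complex) f Z. c * f Z)"
  by standard (auto simp: fun_eq_iff algebra_simps)

lemma hecke_finite_support:
  assumes "f \<in> hecke_algebra"
  shows "finite {D. D \<in> double_cosets \<and> f (coset_rep D) \<noteq> 0}"
  using assms unfolding hecke_algebra_def
proof (induction rule: Modules.module.span_induct_alt[OF module_fun, consumes 1, case_names base step])
  case base
  show ?case by simp
next
  case (step c g f)
  then obtain M where M: "M \<in> double_cosets" "g = char_fun M" by auto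
  have "{D. D \<in> double_cosets \<and> ((\<lambda>Z. c * g Z) + f) (coset_rep D) \<noteq> 0} \<subseteq>
      insert M {D. D \<in> double_cosets \<and> f (coset_rep D) \<noteq> 0}"
    using M by (auto simp: char_fun_coset_rep split: if_splits)
  thus ?case by (rule finite_subset) (simp add: step(2))
qed

lemma hecke_mult_superset:
  assumes "finite S" "finite T" "S \<subseteq> double_cosets" "T \<subseteq> double_cosets"
    and "{D. D \<in> double_cosets \<and> f (coset_rep D) \<noteq> 0} \<subseteq> S"
    and "{D. D \<in> double_cosets \<and> g (coset_rep D) \<noteq> 0} \<subseteq> T"
  shows "(f \<star> g) Z =
    (\<Sum>D\<in>S. \<Sum>E\<in>T. f (coset_rep D) * g (coset_rep E) * hecke_basis_mult D E Z)"
proof -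
  have "(\<Sum>E | E \<in> double_cosets \<and> g (coset_rep E) \<noteq> 0.
      f (coset_rep D) * g (coset_rep E) * hecke_basis_mult D E Z) =
    (\<Sum>E\<in>T. f (coset_rep D) * g (coset_rep E) * hecke_basis_mult D E Z)" for D
    using assms by (intro sum.mono_neutral_left) auto
  thus ?thesis unfolding hecke_mult_def
    using assms by (simp, intro sum.mono_neutral_left) auto
qed

lemma hecke_mult_bilinear:
  assumes f: "f \<in> hecke_algebra" "f' \<in> hecke_algebra" and g: "g \<in> hecke_algebra"
  shows "(\<lambda>Z. c * f Z + f' Z) \<star> g = (\<lambda>Z. c * (f \<star> g) Z + (f' \<star> g) Z)"
    and "g \<star> (\<lambda>Z. c * f Z + f' Z) = (\<lambda>Z. c * (g \<star> f) Z + (g \<star> f') Z)"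
proof -
  let ?s = "\<lambda>f. {D. D \<in> double_cosets \<and> f (coset_rep D) \<noteq> (0::complex)}"
  let ?S = "?s f \<union> ?s f'" and ?T = "?s g" and ?h = "\<lambda>Z. c * f Z + f' Z"
  have fin: "finite ?S" "finite ?T" using assms hecke_finite_support by auto
  have sub: "?S \<subseteq> double_cosets" "?T \<subseteq> double_cosets" "?s ?h \<subseteq> ?S" "?s f \<subseteq> ?S" "?s f' \<subseteq> ?S"
    by auto
  have l: "(k \<star> g) Z = (\<Sum>D\<in>?S. \<Sum>E\<in>?T.
      k (coset_rep D) * g (coset_rep E) * hecke_basis_mult D E Z)" if "?s k \<subseteq> ?S" for k Z
    by (rule hecke_mult_superset[OF fin sub(1,2) that order_refl])
  have r: "(g \<star> k) Z = (\<Sum>D\<in>?T. \<Sum>E\<in>?S.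
      g (coset_rep D) * k (coset_rep E) * hecke_basis_mult D E Z)" if "?s k \<subseteq> ?S" for k Z
    by (rule hecke_mult_superset[OF fin(2,1) sub(2,1) order_refl that])
  show "?h \<star> g = (\<lambda>Z. c * (f \<star> g) Z + (f' \<star> g) Z)"
    by (rule ext, unfold l[OF sub(3)] l[OF sub(4)] l[OF sub(5)] sum_distrib_left
      sum.distrib[symmetric])
      (intro sum.cong refl, simp add: algebra_simps)
  show "g \<star> ?h = (\<lambda>Z. c * (g \<star> f) Z + (g \<star> f') Z)"
    by (rule ext, unfold r[OF sub(3)] r[OF sub(4)] r[OF sub(5)] sum_distrib_left
      sum.distrib[symmetric])
      (intro sum.cong refl, simp add: algebra_simps)
qed

end

theory Submission
  imports Defs
begin

text \<open>A right coset \<open>U X\<close> corresponds to the row lattice of \<open>X\<close>. If \<open>C = W X\<close> with \<open>X \<in> U B U\<close>,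
  then the lattice of \<open>X\<close> contains the first row \<open>(1, 0)\<close> of \<open>C\<close>. Its coefficient vector with
  respect to the rows of \<open>X\<close> is unimodular, hence is the first row of a matrix in \<open>U\<close>, and
  clearing the column below shows \<open>U X = U B\<close>. So only one pair of cosets can contribute to the
  value at \<open>C\<close>, and comparing determinants shows when it does.

  Norm-finiteness serves to make the number of cosets finite: \<open>U A v\<close> depends only on \<open>v\<close>
  modulo \<open>a\<close>.\<close>

no_notation fps_nth (infixl \<open>$\<close> 75)

section \<open>Determinants, units and cancellation for 2 by 2 matrices\<close>

abbreviation (input) diag1 :: "'a::idom \<Rightarrow> 'a^2^2" where
  "diag1 a \<equiv> vector [vector [1, 0], vector [0, a]]"

lemma det_diag1: "det (diag1 a) = a"
  by (simp add: det_2)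

lemma diag1_mult: "diag1 a ** diag1 b = diag1 (a * b)"
  by (simp add: vec_eq_iff forall_2 matrix_matrix_mult_def sum_2)

lemma det_GL2_dvd_1: "u \<in> GL2 \<Longrightarrow> det u dvd 1"
  by (metis GL2_inverse det_I det_mul dvd_triv_left)

lemma GL2I:
  fixes M :: "'a::idom^2^2"
  assumes "det M dvd 1"
  shows "M \<in> GL2"
proof -
  obtain d where d: "1 = det M * d" using assms by (auto simp: dvd_def)
  \<comment> \<open>The adjugate of \<open>M\<close>, scaled by the inverse \<open>d\<close> of its
    determinant.\<close>
  let ?N = "vector [vector [d * M$2$2, - d * M$1$2], vector [- d * M$2$1, d * M$1$1]] :: 'a^2^2"
  have "M ** ?N = mat 1" "?N ** M = mat 1"
    using d by (auto simp: vec_eq_iff forall_2 matrix_matrix_mult_def sum_2 mat_def det_2 algebra_simps)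
  thus ?thesis unfolding GL2_def invertible_def by blast
qed

lemma matrix_mult_right_cancel:
  fixes Z Y M :: "'a::idom^2^2"
  assumes "Z ** M = Y ** M" "det M \<noteq> 0"
  shows "Z = Y"
proof -
  \<comment> \<open>The adjugate of \<open>M\<close>: as \<open>det M\<close> need not be a unit,
    \<open>M\<close> is turned into the scalar \<open>det M\<close>, which cancels in a
    domain.\<close>
  let ?N = "vector [vector [M$2$2, - M$1$2], vector [- M$2$1, M$1$1]] :: 'a^2^2"
  have MN: "W ** M ** ?N = (\<chi> i j. det M * W$i$j)" for W
    by (auto simp: vec_eq_iff forall_2 matrix_matrix_mult_def sum_2 det_2 algebra_simps)
  have "(\<chi> i j. det M * Z$i$j) = (\<chi> i j. det M * Y$i$j)"
    using assms(1) by (simp flip: MN)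
  thus ?thesis using assms(2) by (auto simp: vec_eq_iff)
qed

lemma det_double_coset:
  assumes "Z \<in> double_coset M"
  obtains e where "e dvd 1" "det Z = det M * e"
proof -
  obtain u v where "u \<in> GL2" "v \<in> GL2" "Z = u ** M ** v"
    using assms by (auto simp: double_coset_def)
  thus ?thesis
    by (intro that[of "det u * det v"])
      (auto simp: det_mul mult_ac dest!: det_GL2_dvd_1 intro: mult_dvd_mono[of _ 1 _ 1, simplified])
qed

section \<open>Right cosets inside a double coset and finiteness of their number\<close>

lemma right_coset_eq_iff: "right_coset Z = right_coset Y \<longleftrightarrow> Z \<in> right_coset Y"
  using right_coset_self right_coset_eq by metis

lemma right_cosets_in_double_coset:
  "right_cosets_in (double_coset M) = (\<lambda>v. right_coset (M ** v)) ` GL2"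
proof -
  have 1: "right_coset (u ** M ** v) = right_coset (M ** v)" if "u \<in> GL2" for u v
    using right_coset_GL2_mult[OF that, of "M ** v"] by (simp add: matrix_mul_assoc)
  have 2: "M ** v \<in> double_coset M" if "v \<in> GL2" for v
    using double_coset_mult[OF GL2_one that double_coset_self] by simp
  show ?thesis
  proof (intro equalityI subsetI)
    fix P assume "P \<in> right_cosets_in (double_coset M)"
    thus "P \<in> (\<lambda>v. right_coset (M ** v)) ` GL2"
      by (auto simp: right_cosets_in_def double_coset_def 1)
  next
    fix P assume "P \<in> (\<lambda>v. right_coset (M ** v)) ` GL2"
    thus "P \<in> right_cosets_in (double_coset M)"
      using 2 by (auto simp: right_cosets_in_def)
  qed
qed

lemma right_coset_subset_double_coset:
  assumes "P \<in> right_cosets_in (double_coset M)"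
  shows "P \<subseteq> double_coset M"
proof -
  obtain v where "v \<in> GL2" "P = right_coset (M ** v)"
    using assms by (auto simp: right_cosets_in_double_coset)
  thus ?thesis by (auto simp: right_coset_def double_coset_def matrix_mul_assoc)
qed

text \<open>The witness in the proof is \<open>p = A g A\<^sup>-\<^sup>1\<close> for \<open>A = diag1 a\<close>.\<close>

lemma diag1_mult_mem_right_coset:
  fixes g :: "'a::idom^2^2"
  assumes "g \<in> GL2" "a dvd g$1$2"
  shows "diag1 a ** g \<in> right_coset (diag1 a)"
proof -
  obtain k where k: "g$1$2 = a * k" using assms(2) by (auto simp: dvd_def)
  let ?p = "vector [vector [g$1$1, k], vector [a * g$2$1, g$2$2]] :: 'a^2^2"
  have "det ?p = det g" by (simp add: det_2 k algebra_simps)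
  hence "?p \<in> GL2" using assms(1) by (simp add: GL2I det_GL2_dvd_1)
  moreover have "diag1 a ** g = ?p ** diag1 a"
    by (simp add: vec_eq_iff forall_2 matrix_matrix_mult_def sum_2 k algebra_simps)
  ultimately show ?thesis unfolding right_coset_def by blast
qed

lemma right_coset_mult_right:
  "Z \<in> right_coset Y \<Longrightarrow> Z ** w \<in> right_coset (Y ** w)"
  by (auto simp: right_coset_def matrix_mul_assoc)

text \<open>Since the first rows agree modulo \<open>a\<close>, the upper right entry of
  \<open>v ** w'\<close>, with \<open>w'\<close> inverse to \<open>w\<close>, is congruent to that
  of \<open>w ** w' = mat 1\<close>, so \<open>a\<close> divides it and \<open>diag1 a\<close>
  absorbs \<open>v ** w'\<close>.\<close>

lemma right_coset_diag1_mult_cong: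
  fixes v w :: "'a::idom^2^2"
  assumes "v \<in> GL2" "w \<in> GL2" and cong: "\<And>j. a dvd v$1$j - w$1$j"
  shows "right_coset (diag1 a ** v) = right_coset (diag1 a ** w)"
proof -
  obtain w' where w': "w' \<in> GL2" "w ** w' = mat 1" "w' ** w = mat 1"
    using GL2_inverse[OF assms(2)] .
  have "(w ** w')$1$2 = 0" by (simp add: w' mat_def)
  hence "(v ** w')$1$2 = (v$1$1 - w$1$1) * w'$1$2 + (v$1$2 - w$1$2) * w'$2$2"
    by (simp add: matrix_matrix_mult_def sum_2 algebra_simps)
  hence "a dvd (v ** w')$1$2" using cong by simp
  hence "diag1 a ** (v ** w') ** w \<in> right_coset (diag1 a ** w)"
    using assms w' by (intro right_coset_mult_right diag1_mult_mem_right_coset GL2_mult)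
  moreover have "diag1 a ** (v ** w') ** w = diag1 a ** v ** (w' ** w)"
    by (simp add: matrix_mul_assoc)
  ultimately show ?thesis using w' by (simp add: right_coset_eq)
qed

text \<open>Restates norm-finiteness in terms of divisibility; the witness for \<open>f\<close>
  sends \<open>x\<close> to its residue class modulo \<open>a\<close>.\<close>

lemma finite_residues:
  fixes a :: "'a::idom"
  assumes "norm_finite TYPE('a)" "a \<noteq> 0"
  obtains f :: "'a \<Rightarrow> 'a set" where "finite (range f)" "\<And>x y. f x = f y \<Longrightarrow> a dvd x - y"
proof -
  let ?R = "ring_of_type_algebra :: 'a ring"
  let ?I = "PIdl\<^bsub>?R\<^esub> a"
  let ?f = "\<lambda>x. ?I +>\<^bsub>?R\<^esub> x"
  have f: "?f x = {r * a + x | r. True}" for x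
    by (auto simp: a_r_coset_def r_coset_def cgenideal_def ring_of_type_algebra_def)
  have "range ?f \<subseteq> carrier (?R Quot ?I)"
    by (auto simp: FactRing_def A_RCOSETS_def RCOSETS_def a_r_coset_def ring_of_type_algebra_def)
  hence "finite (range ?f)"
    using assms finite_subset unfolding norm_finite_def by blast
  moreover have "a dvd x - y" if "?f x = ?f y" for x y
  proof -
    have "x \<in> ?f x" by (auto simp: f intro: exI[of _ 0])
    hence "x \<in> ?f y" using that by simp
    thus ?thesis by (auto simp: f)
  qed
  ultimately show ?thesis using that by blast
qed

lemma finite_right_cosets_in:
  fixes a :: "'a::idom"
  assumes "norm_finite TYPE('a)" "a \<noteq> 0"
  shows "finite (right_cosets_in (double_coset (diag1 a)))"
proof -
  obtain f :: "'a \<Rightarrow> 'a set" where fin: "finite (range f)"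
    and f: "\<And>x y. f x = f y \<Longrightarrow> a dvd x - y"
    using finite_residues[OF assms] by blast
  let ?F = "\<lambda>v::'a^2^2. (f (v$1$1), f (v$1$2))"
  \<comment> \<open>Sends a pair of residue classes to the coset given by some matrix whose first
    row has these classes. Pairs that no matrix in \<open>GL2\<close> realizes get an arbitrary
    value, which is harmless because only an upper bound is sought.\<close>
  let ?g = "\<lambda>t. right_coset (diag1 a ** (SOME v. v \<in> GL2 \<and> ?F v = t))"
  have "right_coset (diag1 a ** v) \<in> ?g ` (range f \<times> range f)"
    if v: "v \<in> GL2" for v
  proof
    define w where "w = (SOME w. w \<in> GL2 \<and> ?F w = ?F v)"
    have w: "w \<in> GL2 \<and> ?F w = ?F v" unfolding w_def by (rule someI[of _ v]) (simp add: v)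
    hence "\<forall>j. a dvd v$1$j - w$1$j" using f by (simp add: forall_2)
    hence "right_coset (diag1 a ** v) = right_coset (diag1 a ** w)"
      using v w by (intro right_coset_diag1_mult_cong) auto
    thus "right_coset (diag1 a ** v) = ?g (?F v)" unfolding w_def .
  qed auto
  hence "right_cosets_in (double_coset (diag1 a)) \<subseteq>
      ?g ` (range f \<times> range f)"
    by (auto simp: right_cosets_in_double_coset)
  thus ?thesis using fin finite_subset by blast
qed

section \<open>Which products of representatives reach the coset of \<open>diag1 c\<close>\<close>

lemma mem_right_coset_diag1:
  fixes Z W :: "'a::idom^2^2"
  assumes Z: "Z \<in> double_coset (diag1 b)" and row: "row 1 (W ** Z) = vector [1, 0]"
  shows "Z \<in> right_coset (diag1 b)"
proof -
  obtain e where e: "e dvd 1" "det Z = b * e"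
    by (rule det_double_coset[OF Z, unfolded det_diag1])
  have r: "W$1$1 * Z$1$1 + W$1$2 * Z$2$1 = 1" "W$1$1 * Z$1$2 + W$1$2 * Z$2$2 = 0"
    using row by (auto simp: row_def vec_eq_iff forall_2 matrix_matrix_mult_def sum_2)
  \<comment> \<open>Solves \<open>Z = ?V ** diag1 b\<close>. The first columns must agree. The
    second column of \<open>Z\<close> is orthogonal to the first row of \<open>W\<close>, which
    makes it \<open>b * e\<close> times \<open>(- W$1$2, W$1$1)\<close>; dropping the factor
    \<open>b\<close> gives that of \<open>?V\<close>.\<close>
  let ?V = "vector [vector [Z$1$1, - (W$1$2 * e)], vector [Z$2$1, W$1$1 * e]] :: 'a^2^2"
  have "det ?V = e * (W$1$1 * Z$1$1 + W$1$2 * Z$2$1)" by (simp add: det_2 algebra_simps)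
  hence V: "det ?V dvd 1" using r e by simp
  have d: "b * e = Z$1$1 * Z$2$2 - Z$1$2 * Z$2$1" using e by (simp add: det_2)
  \<comment> \<open>The first row of \<open>W ** Z\<close> times the adjugate of
    \<open>Z\<close>.\<close>
  have "W$1$2 * (b * e) =
      Z$1$1 * (W$1$1 * Z$1$2 + W$1$2 * Z$2$2) - Z$1$2 * (W$1$1 * Z$1$1 + W$1$2 * Z$2$1)"
    "W$1$1 * (b * e) =
      Z$2$2 * (W$1$1 * Z$1$1 + W$1$2 * Z$2$1) - Z$2$1 * (W$1$1 * Z$1$2 + W$1$2 * Z$2$2)"
    unfolding d by (simp_all only: algebra_simps)
  hence "W$1$2 * (b * e) = - Z$1$2" "W$1$1 * (b * e) = Z$2$2"
    unfolding r by simp_all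
  hence "Z = ?V ** diag1 b"
    by (simp add: vec_eq_iff forall_2 matrix_matrix_mult_def sum_2 algebra_simps)
  thus ?thesis using GL2I[OF V] unfolding right_coset_def by blast
qed

text \<open>The coset of \<open>p ** q\<close> depends on \<open>p\<close> only through its coset,
  but on \<open>q\<close> itself; \<open>q_rep\<close> therefore fixes the representative of the
  coset of \<open>diag1 b\<close>.\<close>

lemma mem_right_coset_mult_iff:
  fixes p q :: "'a::idom^2^2"
  assumes p: "p \<in> double_coset (diag1 a)" and q: "q \<in> double_coset (diag1 b)"
    and q_rep: "right_coset q = right_coset (diag1 b) \<Longrightarrow> q = diag1 b"
    and nz: "b \<noteq> 0"
  shows "diag1 c \<in> right_coset (p ** q) \<longleftrightarrow>
    right_coset p = right_coset (diag1 a) \<and> right_coset q = right_coset (diag1 b) \<and>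
    (\<exists>e. e dvd 1 \<and> c = a * b * e)"
proof
  assume "diag1 c \<in> right_coset (p ** q)"
  then obtain w where w: "w \<in> GL2" "diag1 c = w ** p ** q"
    by (auto simp: right_coset_def matrix_mul_assoc)
  have "row 1 (w ** p ** q) = vector [1, 0]"
    by (simp add: row_def vec_eq_iff forall_2 flip: w(2))
  hence Q: "right_coset q = right_coset (diag1 b)"
    using mem_right_coset_diag1[OF q] right_coset_eq by blast
  hence qb: "q = diag1 b" by (rule q_rep)
  obtain e where e: "e dvd 1" "det p = a * e"
    by (rule det_double_coset[OF p, unfolded det_diag1])
  have "det (diag1 c) = det w * det p * det q" by (simp add: w(2) det_mul)
  hence c: "c = a * b * (det w * e)" by (simp add: det_diag1 e qb algebra_simps)
  have unit: "det w * e dvd 1"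
    using mult_dvd_mono[OF det_GL2_dvd_1[OF w(1)] e(1)] by simp
  \<comment> \<open>With \<open>c\<close> known up to a unit, \<open>diag1 c\<close> also factors
    with \<open>diag1 b\<close> on the right; cancelling it isolates the coset of
    \<open>p\<close>.\<close>
  have "w ** p ** diag1 b = diag1 c" using w(2) qb by simp
  also have "\<dots> = diag1 (det w * e) ** diag1 a ** diag1 b"
    unfolding c diag1_mult by (simp add: mult_ac)
  finally have "w ** p = diag1 (det w * e) ** diag1 a"
    by (rule matrix_mult_right_cancel) (simp add: det_diag1 nz)
  hence "right_coset (w ** p) = right_coset (diag1 (det w * e) ** diag1 a)" by simp
  hence "right_coset p = right_coset (diag1 a)"
    using w(1) GL2I[of "diag1 (det w * e)"] unit by (simp add: right_coset_GL2_mult det_diag1)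
  thus "right_coset p = right_coset (diag1 a) \<and> right_coset q = right_coset (diag1 b) \<and>
      (\<exists>e. e dvd 1 \<and> c = a * b * e)"
    using Q c unit by blast
next
  assume *: "right_coset p = right_coset (diag1 a) \<and> right_coset q = right_coset (diag1 b) \<and>
      (\<exists>e. e dvd 1 \<and> c = a * b * e)"
  then obtain e where e: "e dvd 1" "c = a * b * e" by blast
  have "right_coset (p ** q) = right_coset (diag1 a ** diag1 b)"
    using * q_rep right_coset_mult_right[of p "diag1 a" "diag1 b"]
    by (simp add: right_coset_eq_iff)
  moreover have "diag1 c = diag1 e ** (diag1 a ** diag1 b)"
    by (simp add: diag1_mult e(2) mult_ac)
  ultimately show "diag1 c \<in> right_coset (p ** q)"
    using GL2I[of "diag1 e"] e(1) unfolding right_coset_def by (auto simp: det_diag1)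
qed

section \<open>Evaluation of the product at \<open>C\<close>\<close>

theorem theorem5p6:
  fixes a b c :: "'a::idom"
    and A B C :: "'a^2^2"
  assumes "dedekind_domain TYPE('a)"
    and "norm_finite TYPE('a)"
    and "a \<noteq> 0" and "b \<noteq> 0" and "c \<noteq> 0"
    and "A = vector [vector [1, 0], vector [0, a]]"
    and "B = vector [vector [1, 0], vector [0, b]]"
    and "C = vector [vector [1, 0], vector [0, c]]"
  shows "(char_fun (double_coset A) \<star> char_fun (double_coset B)) C =
    (if c \<in> {a * b * u | u. u dvd 1} then 1 else 0)"
proof -
  let ?RA = "right_cosets_in (double_coset A)" and ?RB = "right_cosets_in (double_coset B)"
  define S where "S \<longleftrightarrow> (\<exists>u. u dvd 1 \<and> c = a * b * u)"
  \<comment> \<open>Chosen to satisfy \<open>q_rep\<close>; the product does not depend on the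
    representatives.\<close>
  define rB where "rB Q = (if Q = right_coset B then B else coset_rep Q)" for Q
  have dc: "double_coset A \<in> double_cosets" "double_coset B \<in> double_cosets"
    using assms(3,4) by (auto simp: double_cosets_def nonsingular_def assms(6,7) det_diag1)
  have fin: "finite ?RA" "finite ?RB"
    using finite_right_cosets_in[OF assms(2)] assms(3,4) by (auto simp: assms(6,7))
  have rep: "coset_rep P \<in> P" if "P \<in> right_cosets_in D" for P and D :: "('a^2^2) set"
    using that right_coset_self unfolding coset_rep_def right_cosets_in_def by (metis imageE someI)
  have repB: "rB Q \<in> Q" if "Q \<in> ?RB" for Q
    using rep[OF that] by (simp add: rB_def right_coset_self)
  have coset: "right_coset Z = P" if "P \<in> right_cosets_in D" "Z \<in> P" for P D and Z :: "'a^2^2"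
    using that right_coset_eq by (auto simp: right_cosets_in_def)
  \<comment> \<open>Nested conditionals, so that each sum collapses to its one term at the coset of
    \<open>B\<close> or of \<open>A\<close>.\<close>
  have "char_fun (right_coset (coset_rep P ** rB Q)) C =
      (if Q = right_coset B then if P = right_coset A then if S then 1 else 0 else 0 else 0)"
    if P: "P \<in> ?RA" and Q: "Q \<in> ?RB" for P Q
  proof -
    have eq: "right_coset (coset_rep P) = P" "right_coset (rB Q) = Q"
      using coset P Q rep repB by blast+
    have "C \<in> right_coset (coset_rep P ** rB Q) \<longleftrightarrow>
        right_coset (coset_rep P) = right_coset A \<and> right_coset (rB Q) = right_coset B \<and> S"
      unfolding assms(6-8) S_def
    proof (rule mem_right_coset_mult_iff)
      show "coset_rep P \<in> double_coset (diag1 a)" "rB Q \<in> double_coset (diag1 b)"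
        using right_coset_subset_double_coset P Q rep repB unfolding assms(6,7) by blast+
      show "right_coset (rB Q) = right_coset (diag1 b) \<Longrightarrow> rB Q = diag1 b"
        unfolding eq by (simp add: rB_def assms(7))
    qed fact
    thus ?thesis by (simp add: eq indicator_def)
  qed
  moreover have "right_coset A \<in> ?RA" "right_coset B \<in> ?RB"
    using double_coset_self by (auto simp: right_cosets_in_def)
  \<comment> \<open>Finiteness is essential: a sum over an infinite set is 0 by convention.\<close>
  ultimately have "(\<Sum>P\<in>?RA. \<Sum>Q\<in>?RB. char_fun (right_coset (coset_rep P ** rB Q)) C) =
      (if S then 1 else 0)"
    using fin by simp
  moreover have "hecke_basis_mult (double_coset A) (double_coset B) =
      (\<Sum>P\<in>?RA. \<Sum>Q\<in>?RB. char_fun (right_coset (coset_rep P ** rB Q)))"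
    by (rule hecke_basis_mult_any_reps[OF dc rep repB])
  ultimately show ?thesis
    by (auto simp: hecke_mult_char_fun[OF dc] sum_fun_apply S_def)
qed

end
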